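(* Let $\mathcal{A}=\{H_1,\dots,H_n\}$ be a spanning arrangement of $n$ simple toric hyperplanes in general position on $\mathbb{T}^n$, with normal vectors $\mathbf{a}_1,\dots,\mathbf{a}_n\in\mathbb{Z}^n$, and let $\Theta$ be the $n\times n$ integer matrix whose rows are $\mathbf{a}_1,\dots,\mathbf{a}_n$. Then the number of regions of $\mathcal{A}$, i.e. the number of connected components of $\mathbb{T}^n\setminus\bigcup_{i=1}^nH_i$, equals $|\det(\Theta)|$.
   Context: $\mathbb{T}^n=\mathbb{R}^n/\mathbb{Z}^n$ and $S^1=\mathbb{R}/\mathbb{Z}$. An (affine toric) hyperplane on $\mathbb{T}^n$ with normal vector $\mathbf{a}\in\mathbb{Z}^n\setminus\{0\}$ and intercept $b\in S^1$ is $\{x\in\mathbb{T}^n:\mathbf{a}\cdot x=b\}$; it is simple if the gcd of the entries of $\mathbf{a}$ is $1$. An arrangement is a finite set of hyperplanes. It is in general position if for all distinct $H_1,\dots,H_m$ in it, $\dim(H_1\cap\dots\cap H_m)\le n-m$ when $m\le n$ (satisfied when the intersection is empty), and $H_1\cap\dots\cap H_m=\emptyset$ when $m>n$. It is spanning if some $n$ of its hyperplanes have non-empty intersection (for general position arrangements, equivalently, the normal vectors of some $n$ of its hyperplanes span $\mathbb{R}^n$). *)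

theory Defs
  imports "HOL-Analysis.Analysis"
begin

definition circle_rel :: "real \<Rightarrow> real \<Rightarrow> bool" where
  "circle_rel s t \<longleftrightarrow> s - t \<in> \<int>"

definition torus_rel :: "real ^ 'n \<Rightarrow> real ^ 'n \<Rightarrow> bool" where
  "torus_rel x y \<longleftrightarrow> (\<forall>i. circle_rel (x $ i) (y $ i))"

lemma equivp_circle_rel: "equivp circle_rel"
proof (rule equivpI)
  show "reflp circle_rel" by (simp add: reflp_def circle_rel_def)
  show "symp circle_rel"
    unfolding symp_def circle_rel_def by (metis Ints_minus minus_diff_eq)
  show "transp circle_rel"
  proof (rule transpI)
    fix x y z :: real
    assume "circle_rel x y" "circle_rel y z"
    then have "(x - y) + (y - z) \<in> \<int>"
      unfolding circle_rel_def by (rule Ints_add)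
    then show "circle_rel x z" by (simp add: circle_rel_def)
  qed
qed

lemma equivp_torus_rel: "equivp torus_rel"
proof (rule equivpI)
  show "reflp torus_rel"
    by (simp add: reflp_def torus_rel_def equivp_reflp[OF equivp_circle_rel])
  show "symp torus_rel"
    unfolding symp_def torus_rel_def by (metis equivp_symp[OF equivp_circle_rel])
  show "transp torus_rel"
    unfolding transp_def torus_rel_def by (metis equivp_transp[OF equivp_circle_rel])
qed

quotient_type circle = real / circle_rel
  morphisms rep_circle to_circle
  by (rule equivp_circle_rel)

quotient_type 'n torus = "real ^ 'n" / torus_rel
  morphisms rep_torus to_torus
  by (rule equivp_torus_rel)

text \<open>The torus carries the quotient topology of the projection \<^term>\<open>to_torus\<close>.\<close>

instantiation torus :: (finite) topological_space
begin

definition open_torus :: "'a torus set \<Rightarrow> bool" where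
  "open_torus U \<longleftrightarrow> open (to_torus -` U)"

instance
proof
  show "open (UNIV :: 'a torus set)" by (simp add: open_torus_def)
next
  fix S T :: "'a torus set"
  assume "open S" "open T"
  then show "open (S \<inter> T)" by (simp add: open_torus_def open_Int)
next
  fix K :: "'a torus set set"
  assume "\<forall>S\<in>K. open S"
  then show "open (\<Union>K)" by (auto simp: open_torus_def vimage_Union)
qed

end

lift_definition torus_dot :: "int ^ 'n \<Rightarrow> 'n torus \<Rightarrow> circle" is
  "\<lambda>a x. \<Sum>i\<in>UNIV. of_int (a $ i) * x $ i"
proof -
  fix a :: "int ^ 'n" and x y :: "real ^ 'n"
  assume "torus_rel x y"
  then have "(\<Sum>i\<in>UNIV. of_int (a $ i) * (x $ i - y $ i)) \<in> \<int>"
    by (intro Ints_sum Ints_mult) (auto simp: torus_rel_def circle_rel_def)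
  then show "circle_rel (\<Sum>i\<in>UNIV. of_int (a $ i) * x $ i) (\<Sum>i\<in>UNIV. of_int (a $ i) * y $ i)"
    by (simp add: circle_rel_def right_diff_distrib sum_subtractf)
qed

definition toric_hyperplane :: "int ^ 'n \<Rightarrow> circle \<Rightarrow> 'n torus set" where
  "toric_hyperplane a b = {x. torus_dot a x = b}"

definition has_normal :: "'n::finite torus set \<Rightarrow> int ^ 'n \<Rightarrow> bool" where
  "has_normal H a \<longleftrightarrow> a \<noteq> 0 \<and> (\<exists>b. H = toric_hyperplane a b)"

definition simple_normal :: "int ^ 'n \<Rightarrow> bool" where
  "simple_normal a \<longleftrightarrow> Gcd (range (($) a)) = 1"

definition toric_arrangement :: "'n::finite torus set set \<Rightarrow> bool" where
  "toric_arrangement A \<longleftrightarrow> finite A \<and> (\<forall>H\<in>A. \<exists>a. has_normal H a)"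

text \<open>The dimension of an intersection of hyperplanes is its topological (small inductive)
  dimension; the empty set has dimension \<open>-1\<close>, so it satisfies every bound below.\<close>

definition general_position :: "'n::finite torus set set \<Rightarrow> bool" where
  "general_position A \<longleftrightarrow>
     (\<forall>B\<subseteq>A. finite B \<and> B \<noteq> {} \<longrightarrow>
        (card B \<le> CARD('n) \<longrightarrow> top_of_set (\<Inter>B) dim_le (int CARD('n) - int (card B))) \<and>
        (card B > CARD('n) \<longrightarrow> \<Inter>B = {}))"

definition spanning :: "'n::finite torus set set \<Rightarrow> bool" where
  "spanning A \<longleftrightarrow> (\<exists>B\<subseteq>A. card B = CARD('n) \<and> \<Inter>B \<noteq> {})"

definition regions :: "'n::finite torus set set \<Rightarrow> 'n torus set set" where
  "regions A = components (- \<Union>A)"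

end

theory Submission
  imports Defs
begin

text \<open>
  The proof measures the regions. Let \<open>c\<close> lift the intercepts to the reals. In \<open>\<real>\<^sup>n\<close> the lifted
  hyperplanes cut out the open parallelepipeds \<open>{x. c + k < \<Theta> x < c + k + 1}\<close>, one for each
  integer vector \<open>k\<close> (lemmas \<open>in_some_cell\<close> and \<open>cell_index_unique\<close>). They are convex, and translation by
  an integer vector \<open>m\<close> carries the cell of \<open>k\<close> to that of \<open>k + \<Theta> m\<close> (\<open>cell_translate\<close>), so
  the images of two cells in the torus coincide or are disjoint. Hence these images, being open
  and connected, are the regions (\<open>components_Union_open_connected\<close>).

  The torus carries a volume of total mass 1, obtained by pulling sets back to the unit cube. If
  \<open>det \<Theta> \<noteq> 0\<close>, distinct integer translates of a cell are disjoint, so a region has the same volume as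
  a cell that lies over it (\<open>torus_volume_image\<close>), which is \<open>1 / \<bar>det \<Theta>\<bar>\<close> because \<open>\<Theta>\<close> maps the cell
  onto a unit box (\<open>emeasure_cell\<close>). The hyperplanes are null sets
  (\<open>null_sets_integer_levels\<close>), so the volumes of the regions add up to 1, and there must be exactly
  \<open>\<bar>det \<Theta>\<bar>\<close> regions.

  That the determinant is nonzero comes from spanning and general position together: the \<open>n\<close>
  hyperplanes have a common point and their intersection has dimension at most 0, whereas a kernel
  vector of \<open>\<Theta>\<close> would put the image of a whole line into the intersection
  (\<open>det_nonzero_if_intersection_dim_le_0\<close>).
\<close>

section \<open>The projection from Euclidean space to the torus\<close>

definition int_vec :: "int ^ 'n \<Rightarrow> real ^ 'n" where
  "int_vec m = (\<chi> i. of_int (m $ i))"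

lemma int_vec_nth [simp]: "int_vec m $ i = of_int (m $ i)"
  by (simp add: int_vec_def)

lemma to_torus_eq_iff: "to_torus x = to_torus y \<longleftrightarrow> (\<exists>m. y = x + int_vec m)"
proof
  assume "to_torus x = to_torus y"
  then have "torus_rel y x"
    by (metis torus.abs_eq_iff)
  then have "\<forall>i. \<exists>k. y $ i - x $ i = of_int k"
    by (auto simp: torus_rel_def circle_rel_def elim: Ints_cases)
  then obtain f where f: "\<And>i. y $ i - x $ i = of_int (f i)"
    by metis
  have "y = x + int_vec (\<chi> i. f i)"
    unfolding vec_eq_iff using f by (simp add: algebra_simps)
  then show "\<exists>m. y = x + int_vec m" ..
next
  assume "\<exists>m. y = x + int_vec m"
  then obtain m where "y = x + int_vec m" ..
  then have "torus_rel y x"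
    by (simp add: torus_rel_def circle_rel_def)
  then show "to_torus x = to_torus y"
    by (metis torus.abs_eq_iff)
qed

lemma surj_to_torus: "surj to_torus"
  by (metis Quotient3_abs_rep Quotient3_torus surjI)

lemma vimage_image_to_torus:
  "to_torus -` to_torus ` S = (\<Union>m. {x. x + int_vec m \<in> S})"
proof -
  have "to_torus x \<in> to_torus ` S \<longleftrightarrow> (\<exists>m. x + int_vec m \<in> S)" for x
    unfolding image_iff to_torus_eq_iff by blast
  then show ?thesis
    by auto
qed

lemma open_image_to_torus:
  fixes S :: "(real ^ 'n::finite) set"
  assumes "open S"
  shows "open (to_torus ` S)"
proof -
  have "open ((\<lambda>x. x + int_vec m) -` S)" for m :: "int ^ 'n"
    by (rule open_vimage[OF assms]) (intro continuous_intros)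
  then have "open {x. x + int_vec m \<in> S}" for m :: "int ^ 'n"
    by (simp add: vimage_def)
  then show ?thesis
    unfolding open_torus_def vimage_image_to_torus by blast
qed

lemma continuous_on_to_torus: "continuous_on S (to_torus :: real ^ 'n::finite \<Rightarrow> 'n torus)"
proof -
  have "continuous_on UNIV (to_torus :: real ^ 'n::finite \<Rightarrow> 'n torus)"
    by (subst continuous_on_open_vimage) (auto simp: open_torus_def)
  then show ?thesis
    by (rule continuous_on_subset) simp
qed

lemma open_Compl_torus_singleton:
  fixes q :: "'n::finite torus"
  shows "open (- {q})"
proof -
  obtain y where q: "q = to_torus y"
    using surj_to_torus by blast
  have eq: "to_torus -` (- {q}) = (\<Union>i. (\<lambda>x. x $ i - y $ i) -` (- \<int>))"
    by (auto simp: q torus.abs_eq_iff torus_rel_def circle_rel_def)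
  have "open ((\<lambda>x::real^'n. x $ i - y $ i) -` (- \<int>))" for i
    by (rule open_vimage) (auto simp: open_closed intro!: continuous_intros)
  then show ?thesis
    unfolding open_torus_def eq by blast
qed

section \<open>Volume on the torus\<close>

definition unit_cube :: "(real ^ 'n) set" where
  "unit_cube = {x. \<forall>i. 0 \<le> x $ i \<and> x $ i < 1}"

text \<open>Haar measure of the torus, normalised to total mass 1. The half-open unit cube contains exactly one
  representative of each point, so pulling back to it counts every point once.\<close>

definition torus_volume :: "'n::finite torus set \<Rightarrow> ennreal" where
  "torus_volume S = emeasure lborel (unit_cube \<inter> to_torus -` S)"

lemma unit_cube_sets [measurable]: "unit_cube \<in> sets (borel :: (real ^ 'n::finite) measure)"
proof -
  have eq: "unit_cube = (\<Inter>i. {x::real^'n. 0 \<le> x $ i} \<inter> {x. x $ i < 1})"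
    by (auto simp: unit_cube_def)
  have "closed {x::real^'n. 0 \<le> x $ i}" "open {x::real^'n. x $ i < 1}" for i
    by (intro closed_Collect_le open_Collect_less continuous_intros)+
  then have "(\<Inter>i. {x::real^'n. 0 \<le> x $ i} \<inter> {x. x $ i < 1}) \<in> sets borel"
    by (intro sets.finite_INT sets.Int borel_closed borel_open) auto
  with eq show ?thesis
    by simp
qed

lemma unit_cube_translates_cover: "\<exists>m. x - int_vec m \<in> unit_cube"
  by (rule exI[of _ "\<chi> i. \<lfloor>x $ i\<rfloor>"]) (simp add: unit_cube_def, linarith)

lemma unit_cube_translates_disjoint:
  assumes "x - int_vec m \<in> unit_cube" "x - int_vec k \<in> unit_cube"
  shows "m = k"
proof -
  have "m $ i = \<lfloor>x $ i\<rfloor>" "k $ i = \<lfloor>x $ i\<rfloor>" for i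
    using assms unfolding unit_cube_def
    by (intro floor_unique[symmetric]; simp add: algebra_simps)+
  then show ?thesis
    by (simp add: vec_eq_iff)
qed

lemma emeasure_translated_unit_box:
  fixes c :: "real ^ 'n::finite"
  shows "emeasure lborel (box c (c + 1)) = 1" "emeasure lborel (cbox c (c + 1)) = 1"
proof -
  have "1 \<bullet> b = 1" if "b \<in> Basis" for b :: "real^'n"
    using that by (auto simp: Basis_vec_def inner_axis)
  then show "emeasure lborel (box c (c + 1)) = 1" "emeasure lborel (cbox c (c + 1)) = 1"
    by (simp_all add: emeasure_lborel_box_eq emeasure_lborel_cbox_eq inner_add_left)
qed

lemma emeasure_unit_cube: "emeasure lborel (unit_cube :: (real ^ 'n::finite) set) = 1"
proof -
  have "unit_cube \<subseteq> cbox 0 (1 :: real^'n)"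
    by (auto simp: unit_cube_def mem_box_cart less_imp_le)
  moreover have "box 0 (1 :: real^'n) \<subseteq> unit_cube"
    by (auto simp: unit_cube_def mem_box_cart less_imp_le)
  moreover have "emeasure lborel (box 0 (1 :: real^'n)) = 1" "emeasure lborel (cbox 0 (1 :: real^'n)) = 1"
    using emeasure_translated_unit_box[of "0 :: real^'n"] by simp_all
  ultimately show ?thesis
    by (metis antisym emeasure_mono sets_lborel borel_closed closed_cbox unit_cube_sets)
qed

lemma emeasure_lborel_translate:
  fixes c :: "'a::euclidean_space"
  assumes "S \<in> sets borel"
  shows "emeasure lborel {x. x + c \<in> S} = emeasure lborel S"
proof -
  have "emeasure lborel S = emeasure (distr lborel borel ((+) c)) S"
    by (simp add: lborel_distr_plus)
  also have "\<dots> = emeasure lborel ((+) c -` S \<inter> space lborel)"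
    by (rule emeasure_distr) (use assms in auto)
  also have "(+) c -` S \<inter> space lborel = {x. x + c \<in> S}"
    by (auto simp: add.commute)
  finally show ?thesis ..
qed

text \<open>When the integer translates of \<open>S\<close> are disjoint, the projection is injective on \<open>S\<close>. The preimage
  of the image in the unit cube then consists of pieces of the translates of \<open>S\<close>; moving each piece
  back by its own translation reassembles \<open>S\<close>, because the translates of the cube tile the space.\<close>

lemma torus_volume_image:
  fixes S :: "(real ^ 'n::finite) set"
  assumes S: "S \<in> sets borel"
    and free: "\<And>x m. x \<in> S \<Longrightarrow> x + int_vec m \<in> S \<Longrightarrow> m = 0"
  shows "torus_volume (to_torus ` S) = emeasure lborel S"
proof -
  let ?T = "\<lambda>m. unit_cube \<inter> {x. x + int_vec m \<in> S}"
  let ?U = "\<lambda>m. {x. x - int_vec m \<in> unit_cube} \<inter> S"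
  have inj: "m = k" if "x + int_vec m \<in> S" "x + int_vec k \<in> S" for x m k
  proof -
    have "x + int_vec m + int_vec (k - m) = x + int_vec k"
      by (simp add: vec_eq_iff)
    then show ?thesis
      using free[of "x + int_vec m" "k - m"] that by (metis right_minus_eq)
  qed
  have pre: "{x. x + c \<in> B} \<in> sets borel" if "B \<in> sets borel" for c :: "real^'n" and B
  proof -
    have "(\<lambda>x. x + c) -` B \<inter> space borel \<in> sets borel"
      by (rule measurable_sets[OF _ that]) simp
    then show ?thesis
      by (simp add: vimage_def)
  qed
  have U: "?U m \<in> sets borel" for m
    using pre[of unit_cube "- int_vec m"] S by auto
  have "torus_volume (to_torus ` S) = emeasure lborel (\<Union>m. ?T m)"
    unfolding torus_volume_def vimage_image_to_torus by (rule arg_cong[of _ _ "emeasure lborel"]) blast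
  also have "\<dots> = (\<integral>\<^sup>+m. emeasure lborel (?T m) \<partial>count_space UNIV)"
    by (rule emeasure_UN_countable)
       (use pre[OF S] inj in \<open>auto simp: disjoint_family_on_def\<close>)
  also have "\<dots> = (\<integral>\<^sup>+m. emeasure lborel (?U m) \<partial>count_space UNIV)"
  proof (rule nn_integral_cong)
    fix m
    have "?T m = {x. x + int_vec m \<in> ?U m}"
      by auto
    then show "emeasure lborel (?T m) = emeasure lborel (?U m)"
      using emeasure_lborel_translate[OF U] by metis
  qed
  also have "\<dots> = emeasure lborel (\<Union>m. ?U m)"
    by (rule emeasure_UN_countable[symmetric])
       (use U unit_cube_translates_disjoint in \<open>auto simp: disjoint_family_on_def\<close>)
  also have "(\<Union>m. ?U m) = S"
    using unit_cube_translates_cover by blast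
  finally show ?thesis .
qed

section \<open>Renaming the coordinates of Euclidean space\<close>

text \<open>Conjugation by \<open>g\<close> is a sign-preserving bijection between the permutations of the two index types,
  and it matches the terms of the two Leibniz expansions.\<close>

lemma det_reindex:
  fixes M :: "'a::comm_ring_1 ^ 'n::finite ^ 'n" and g :: "'m::finite \<Rightarrow> 'n"
  assumes "bij g"
  shows "det (\<chi> i j. M $ g i $ g j) = det M"
proof -
  have inj: "inj g"
    using assms by (rule bij_is_inj)
  have "map_permutation UNIV g = (\<lambda>p x. if x \<in> UNIV then g (p (inv g x)) else x)"
    by (auto simp: fun_eq_iff map_permutation_def restrict_id_def bij_is_surj[OF assms])
  with bij_betw_permutations[OF assms]
  have bij: "bij_betw (map_permutation UNIV g) {p. p permutes UNIV} {p. p permutes UNIV}"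
    by simp
  have "det M = (\<Sum>p | p permutes UNIV. of_int (sign p) * (\<Prod>j\<in>UNIV. M $ j $ p j))"
    by (simp add: det_def)
  also have "\<dots> = (\<Sum>p | p permutes UNIV. of_int (sign (map_permutation UNIV g p)) *
      (\<Prod>j\<in>UNIV. M $ j $ map_permutation UNIV g p j))"
    by (rule sum.reindex_bij_betw[OF bij, symmetric])
  also have "\<dots> = (\<Sum>p | p permutes UNIV. of_int (sign p) * (\<Prod>i\<in>UNIV. M $ g i $ g (p i)))"
  proof (rule sum.cong)
    fix p :: "'m \<Rightarrow> 'm" assume "p \<in> {p. p permutes UNIV}"
    moreover have "(\<Prod>j\<in>UNIV. M $ j $ map_permutation UNIV g p j) =
        (\<Prod>i\<in>UNIV. M $ g i $ map_permutation UNIV g p (g i))"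
      by (rule prod.reindex_bij_betw[OF assms, symmetric])
    ultimately show "of_int (sign (map_permutation UNIV g p)) * (\<Prod>j\<in>UNIV. M $ j $ map_permutation UNIV g p j) =
        of_int (sign p) * (\<Prod>i\<in>UNIV. M $ g i $ g (p i))"
      by (simp add: sign_map_permutation inj map_permutation_apply)
  qed simp
  finally show ?thesis
    by (simp add: det_def)
qed

lemma emeasure_lborel_box_cart:
  fixes l u :: "real ^ 'n::finite"
  assumes "\<And>i. l $ i \<le> u $ i"
  shows "emeasure lborel (box l u) = ennreal (\<Prod>i\<in>UNIV. u $ i - l $ i)"
proof -
  have Basis: "Basis = (\<lambda>i::'n. axis i (1::real)) ` UNIV"
    by (auto simp: Basis_vec_def)
  have "inj (\<lambda>i::'n. axis i (1::real))"
    by (simp add: inj_on_def axis_eq_axis)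
  then have "(\<Prod>b\<in>Basis. (u - l) \<bullet> b) = (\<Prod>i\<in>UNIV. u $ i - l $ i)"
    by (simp add: Basis prod.reindex inner_axis)
  moreover have "\<forall>b\<in>Basis. l \<bullet> b \<le> u \<bullet> b"
    using assms by (auto simp: Basis inner_axis)
  ultimately show ?thesis
    by (simp add: emeasure_lborel_box_eq)
qed

text \<open>Renaming coordinates turns a box into a box with the same side lengths, and Lebesgue measure is
  determined by its values on boxes.\<close>

lemma distr_lborel_reindex:
  fixes g :: "'m::finite \<Rightarrow> 'n::finite"
  assumes "bij g"
  shows "distr lborel borel (\<lambda>x :: real ^ 'n. \<chi> i. x $ g i) = lborel"
proof (rule lborel_eqI[symmetric])
  let ?f = "\<lambda>x :: real ^ 'n. \<chi> i. x $ g i"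
  let ?h = "\<lambda>x :: real ^ 'm. \<chi> j. x $ inv g j"
  have meas: "?f \<in> borel_measurable borel"
    by (intro borel_measurable_continuous_onI continuous_intros)
  fix l u :: "real ^ 'm"
  assume "\<And>b. b \<in> Basis \<Longrightarrow> l \<bullet> b \<le> u \<bullet> b"
  then have lu: "l $ i \<le> u $ i" for i
    by (metis axis_in_Basis_iff Basis_real_def cart_eq_inner_axis insertI1)
  have "?f -` box l u = box (?h l) (?h u)"
    using assms by (auto simp: mem_box_cart) (metis bij_inv_eq_iff)+
  then have "emeasure (distr lborel borel ?f) (box l u) = emeasure lborel (box (?h l) (?h u))"
    using meas by (subst emeasure_distr) auto
  also have "\<dots> = ennreal (\<Prod>j\<in>UNIV. u $ inv g j - l $ inv g j)"
    using lu by (subst emeasure_lborel_box_cart) auto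
  also have "(\<Prod>j\<in>UNIV. u $ inv g j - l $ inv g j) = (\<Prod>i\<in>UNIV. u $ i - l $ i)"
    by (rule prod.reindex_bij_betw) (rule bij_imp_bij_inv[OF assms])
  also have "ennreal \<dots> = emeasure lborel (box l u)"
    using lu by (rule emeasure_lborel_box_cart[symmetric])
  also have "\<dots> = (\<Prod>b\<in>Basis. (u - l) \<bullet> b)"
    using \<open>\<And>b. b \<in> Basis \<Longrightarrow> l \<bullet> b \<le> u \<bullet> b\<close> by (rule emeasure_lborel_box)
  finally show "emeasure (distr lborel borel ?f) (box l u) = (\<Prod>b\<in>Basis. (u - l) \<bullet> b)" .
qed simp

text \<open>
  The change-of-variables formula \<open>measure_linear_image\<close> is stated for well-ordered index types,
  while the coordinates of the torus are indexed by an arbitrary finite type. This copy of a finite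
  type is ordered by some enumeration; renaming coordinates along the bijection with it changes
  neither determinants nor Lebesgue measure, so the formula carries over.
\<close>

typedef 'a ordered_copy = "UNIV :: 'a set"
  by simp

lemma bij_Rep_ordered_copy: "bij Rep_ordered_copy"
  by (metis Abs_ordered_copy_inverse Rep_ordered_copy_inverse UNIV_I bijI')

instance ordered_copy :: (finite) finite
proof
  show "finite (UNIV :: 'a ordered_copy set)"
    by (rule finite_imageD[of Rep_ordered_copy]) (simp_all add: bij_is_inj[OF bij_Rep_ordered_copy])
qed

instantiation ordered_copy :: (finite) wellorder
begin

definition position :: "'a ordered_copy \<Rightarrow> nat" where
  "position = (SOME f. inj f)"

definition less_eq_ordered_copy :: "'a ordered_copy \<Rightarrow> 'a ordered_copy \<Rightarrow> bool" where
  "x \<le> y \<longleftrightarrow> position x \<le> position y"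

definition less_ordered_copy :: "'a ordered_copy \<Rightarrow> 'a ordered_copy \<Rightarrow> bool" where
  "x < y \<longleftrightarrow> position x < position y"

instance
proof
  fix x y z :: "'a ordered_copy"
  have "\<exists>f :: 'a ordered_copy \<Rightarrow> nat. inj f"
    using finite_imp_inj_to_nat_seg[of "UNIV :: 'a ordered_copy set"] by auto
  then have "inj (position :: 'a ordered_copy \<Rightarrow> nat)"
    unfolding position_def by (rule someI_ex)
  then show "x = y" if "x \<le> y" "y \<le> x"
    using that by (auto simp: less_eq_ordered_copy_def inj_def)
  show "x < y \<longleftrightarrow> x \<le> y \<and> \<not> y \<le> x" "x \<le> x" "x \<le> y \<or> y \<le> x"
    by (auto simp: less_eq_ordered_copy_def less_ordered_copy_def)
  show "x \<le> z" if "x \<le> y" "y \<le> z"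
    using that by (simp add: less_eq_ordered_copy_def)
next
  fix P :: "'a ordered_copy \<Rightarrow> bool" and x
  assume step: "\<And>x. (\<And>y. y < x \<Longrightarrow> P y) \<Longrightarrow> P x"
  show "P x"
  proof (induction x rule: measure_induct_rule[of position])
    case (less x)
    show ?case
      by (rule step) (rule less, simp only: less_ordered_copy_def)
  qed
qed

end

section \<open>Parallelepiped cells\<close>

definition cell :: "real ^ 'n ^ 'n \<Rightarrow> real ^ 'n \<Rightarrow> int ^ 'n \<Rightarrow> (real ^ 'n) set" where
  "cell M c k = (*v) M -` box (c + int_vec k) (c + int_vec k + 1)"

lemma mem_cell_iff:
  "x \<in> cell M c k \<longleftrightarrow>
     (\<forall>i. c $ i + of_int (k $ i) < (M *v x) $ i \<and> (M *v x) $ i < c $ i + of_int (k $ i) + 1)"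
  by (simp add: cell_def mem_box_cart)

lemma open_cell: "open (cell M c k)"
  unfolding cell_def by (rule open_vimage) (auto intro: matrix_vector_mult_linear_continuous_on)

lemma convex_cell: "convex (cell M c k)"
  unfolding cell_def by (rule convex_linear_vimage) auto

lemma cell_index_unique:
  assumes "x \<in> cell M c k" "x \<in> cell M c l"
  shows "k = l"
proof -
  have "k $ i = \<lfloor>(M *v x) $ i - c $ i\<rfloor>" "l $ i = \<lfloor>(M *v x) $ i - c $ i\<rfloor>" for i
    using assms unfolding mem_cell_iff
    by (intro floor_unique[symmetric]; smt (verit))+
  then show ?thesis
    by (simp add: vec_eq_iff)
qed

lemma in_some_cell:
  assumes "\<And>i. (M *v x) $ i - c $ i \<notin> \<int>"
  shows "\<exists>k. x \<in> cell M c k"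
proof
  show "x \<in> cell M c (\<chi> i. \<lfloor>(M *v x) $ i - c $ i\<rfloor>)"
    unfolding mem_cell_iff
  proof
    fix i
    let ?t = "(M *v x) $ i - c $ i"
    have "of_int \<lfloor>?t\<rfloor> \<noteq> ?t"
      using assms[of i] by (metis Ints_of_int)
    then show "c $ i + of_int ((\<chi> i. \<lfloor>(M *v x) $ i - c $ i\<rfloor>) $ i) < (M *v x) $ i \<and>
        (M *v x) $ i < c $ i + of_int ((\<chi> i. \<lfloor>(M *v x) $ i - c $ i\<rfloor>) $ i) + 1"
      by (simp, linarith)
  qed
qed

lemma not_Ints_if_in_cell:
  assumes "x \<in> cell M c k"
  shows "(M *v x) $ i - c $ i \<notin> \<int>"
proof
  assume "(M *v x) $ i - c $ i \<in> \<int>"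
  then obtain z where "(M *v x) $ i - c $ i = of_int z"
    by (auto elim: Ints_cases)
  moreover have "c $ i + of_int (k $ i) < (M *v x) $ i \<and> (M *v x) $ i < c $ i + of_int (k $ i) + 1"
    using assms by (auto simp: mem_cell_iff)
  ultimately have "of_int (k $ i) < (of_int z :: real)" "(of_int z :: real) < of_int (k $ i + 1)"
    by auto
  then have "k $ i < z" "z < k $ i + 1"
    by (simp_all only: of_int_less_iff)
  then show False
    by linarith
qed

definition real_matrix :: "int ^ 'n ^ 'm \<Rightarrow> real ^ 'n ^ 'm" where
  "real_matrix N = (\<chi> i j. of_int (N $ i $ j))"

lemma det_real_matrix: "det (real_matrix N) = of_int (det N)"
  by (simp add: det_def real_matrix_def)

lemma real_matrix_mult_int_vec: "real_matrix N *v int_vec m = int_vec (N *v m)"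
  by (simp add: vec_eq_iff matrix_vector_mult_def real_matrix_def)

text \<open>The projection to the torus therefore identifies the cells whose indices differ by an element
  of the lattice spanned by the columns of \<open>N\<close>.\<close>

lemma cell_translate:
  "x + int_vec m \<in> cell (real_matrix N) c (k + N *v m) \<longleftrightarrow> x \<in> cell (real_matrix N) c k"
  by (simp add: mem_cell_iff matrix_vector_right_distrib real_matrix_mult_int_vec algebra_simps)

text \<open>The cell is the image of a unit box under the inverse matrix.\<close>

lemma emeasure_cell_wellorder:
  fixes M :: "real ^ 'n::{finite,wellorder} ^ 'n::_"
  assumes d: "det M \<noteq> 0"
  shows "emeasure lborel (cell M c k) = ennreal (1 / \<bar>det M\<bar>)"
proof -
  let ?B = "box (c + int_vec k) (c + int_vec k + 1)"
  obtain M' where M': "M ** M' = mat 1" "M' ** M = mat 1"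
    using d invertible_det_nz[of M] unfolding invertible_def by blast
  have MM': "M *v (M' *v x) = x" "M' *v (M *v x) = x" for x
    by (simp_all add: matrix_vector_mul_assoc M')
  have cell: "cell M c k = (*v) M' ` ?B"
  proof (intro equalityI subsetI)
    fix x assume "x \<in> cell M c k"
    then have "M *v x \<in> ?B"
      by (simp add: cell_def)
    then have "M' *v (M *v x) \<in> (*v) M' ` ?B"
      by (rule imageI)
    then show "x \<in> (*v) M' ` ?B"
      by (simp only: MM')
  qed (auto simp: cell_def MM')
  have "det M * det M' = 1"
    by (metis M'(1) det_I det_mul)
  then have d': "\<bar>det M'\<bar> = 1 / \<bar>det M\<bar>"
    using d by (simp add: abs_mult[symmetric] eq_divide_eq mult.commute)
  have B: "?B \<in> lmeasurable"
    by simp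
  have lin: "linear ((*v) M')"
    by simp
  have "cell M c k \<in> lmeasurable"
    unfolding cell by (rule measurable_linear_image[OF lin B])
  moreover have "measure lebesgue (cell M c k) = 1 / \<bar>det M\<bar> * measure lebesgue ?B"
    unfolding cell measure_linear_image[OF lin B] by (simp only: matrix_of_matrix_vector_mul d')
  moreover have "measure lebesgue ?B = 1"
    using emeasure_translated_unit_box(1)[of "c + int_vec k"] by (simp add: measure_def)
  ultimately have "emeasure lebesgue (cell M c k) = ennreal (1 / \<bar>det M\<bar>)"
    by (simp add: emeasure_eq_measure2)
  then show ?thesis
    by (simp add: open_cell borel_open)
qed

text \<open>The general case follows by renaming the coordinates by their well-ordered copies.\<close>

lemma emeasure_cell:
  fixes M :: "real ^ 'n::finite ^ 'n"
  assumes "det M \<noteq> 0"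
  shows "emeasure lborel (cell M c k) = ennreal (1 / \<bar>det M\<bar>)"
proof -
  let ?g = "Rep_ordered_copy :: 'n ordered_copy \<Rightarrow> 'n"
  let ?f = "\<lambda>x :: real ^ 'n. \<chi> i. x $ ?g i"
  let ?M = "\<chi> i j. M $ ?g i $ ?g j"
  let ?C = "cell ?M (?f c) (\<chi> i. k $ ?g i)"
  have det: "det ?M = det M"
    by (rule det_reindex[OF bij_Rep_ordered_copy])
  have M: "(?M *v ?f x) $ i = (M *v x) $ ?g i" for x i
    using sum.reindex_bij_betw[OF bij_Rep_ordered_copy, of "\<lambda>j. M $ ?g i $ j * x $ j"]
    by (simp add: matrix_vector_mult_def)
  have all: "(\<forall>i. P i) \<longleftrightarrow> (\<forall>j. P (?g j))" for P
    using bij_is_surj[OF bij_Rep_ordered_copy] by (metis surjD)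
  have "x \<in> cell M c k \<longleftrightarrow> ?f x \<in> ?C" for x
    unfolding mem_cell_iff M by (subst all) simp
  then have "cell M c k = ?f -` ?C"
    by auto
  moreover have "?f \<in> borel_measurable borel"
    by (intro borel_measurable_continuous_onI continuous_intros)
  ultimately have "emeasure lborel (cell M c k) = emeasure (distr lborel borel ?f) ?C"
    by (subst emeasure_distr) (auto intro: borel_open open_cell)
  also have "\<dots> = ennreal (1 / \<bar>det M\<bar>)"
    unfolding distr_lborel_reindex[OF bij_Rep_ordered_copy]
    using emeasure_cell_wellorder[of ?M] assms by (simp add: det)
  finally show ?thesis .
qed

section \<open>Toric hyperplanes\<close>

lemma to_torus_in_hyperplane_iff:
  "to_torus x \<in> toric_hyperplane (row i N) (to_circle t) \<longleftrightarrow> (real_matrix N *v x) $ i - t \<in> \<int>"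
  by (simp add: toric_hyperplane_def torus_dot.abs_eq circle.abs_eq_iff circle_rel_def
      matrix_vector_mult_def real_matrix_def row_def)

text \<open>A kernel vector of the matrix gives a line through a lift of \<open>p\<close> whose image stays in the
  intersection. That image is connected and contains a second point, but in a space of dimension at
  most 0 any two points that an open set distinguishes are separated by a clopen set.\<close>

lemma det_nonzero_if_intersection_dim_le_0:
  fixes N :: "int ^ 'n::finite ^ 'n"
  assumes "p \<in> (\<Inter>i. toric_hyperplane (row i N) (b i))"
    and "top_of_set (\<Inter>i. toric_hyperplane (row i N) (b i)) dim_le 0"
  shows "det N \<noteq> 0"
proof
  let ?Y = "\<Inter>i. toric_hyperplane (row i N) (b i)"
  let ?M = "real_matrix N"
  assume "det N = 0"
  then have "\<not> invertible ?M"
    by (simp add: invertible_det_nz det_real_matrix)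
  then obtain w where w: "?M *v w = 0" "w \<noteq> 0"
    using matrix_left_invertible_ker[of ?M] invertible_left_inverse[of ?M] by blast
  then obtain j where j: "w $ j \<noteq> 0"
    by (auto simp: vec_eq_iff)
  \<comment> \<open>Scaling one coordinate to 1/2 ensures that \<open>v\<close> is not an integer vector, so that moving by \<open>v\<close>
    leads to a different point of the torus.\<close>
  define v where "v = (1 / (2 * w $ j)) *\<^sub>R w"
  have Mv: "?M *v v = 0"
    by (simp add: v_def w scaleR_matrix_vector_assoc[symmetric] matrix_vector_mult_scaleR)
  have vj: "v $ j = 1 / 2"
    using j by (simp add: v_def)
  obtain x where x: "p = to_torus x"
    using surj_to_torus by blast
  define q where "q = to_torus (x + v)"
  define L where "L = to_torus ` ((\<lambda>t. x + t *\<^sub>R v) ` UNIV)"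
  have "L \<subseteq> ?Y"
  proof -
    have "to_torus (x + t *\<^sub>R v) \<in> toric_hyperplane (row i N) (b i)" for t i
    proof -
      obtain s where s: "b i = to_circle s"
        by (metis Quotient3_abs_rep Quotient3_circle)
      have "?M *v (x + t *\<^sub>R v) = ?M *v x"
        by (simp add: matrix_vector_right_distrib matrix_vector_mult_scaleR Mv)
      then show ?thesis
        using assms(1) s to_torus_in_hyperplane_iff[of _ i N s] x by (metis INT_iff UNIV_I)
    qed
    then show ?thesis
      by (auto simp: L_def)
  qed
  moreover have "connected L"
    unfolding L_def
    by (intro connected_continuous_image continuous_on_to_torus continuous_intros connected_UNIV)
  ultimately have L: "connectedin (top_of_set ?Y) L"
    by (simp add: connectedin_subtopology)
  have pL: "p \<in> L"
    unfolding L_def x by (intro imageI image_eqI[of _ _ 0]) auto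
  have qL: "q \<in> L"
    unfolding L_def q_def by (intro imageI image_eqI[of _ _ 1]) auto
  have "p \<noteq> q"
  proof
    assume "p = q"
    then obtain m where "x + v = x + int_vec m"
      by (auto simp: x q_def to_torus_eq_iff)
    then have "1 / 2 = (of_int (m $ j) :: real)"
      using vj by (metis add_left_cancel int_vec_nth)
    then have "of_int 1 = (of_int (2 * m $ j) :: real)"
      by simp
    then have "1 = 2 * m $ j"
      by (simp only: of_int_eq_iff)
    then show False
      by presburger
  qed
  moreover have "openin (top_of_set ?Y) (?Y \<inter> - {q})"
    using open_Compl_torus_singleton by blast
  ultimately obtain U where "openin (top_of_set ?Y) U" "closedin (top_of_set ?Y) U" "p \<in> U" "q \<notin> U"
    using assms unfolding dimension_le_0_neighbourhood_base_of_clopen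
    by (subst (asm) open_neighbourhood_base_of) (auto, blast)
  then show False
    using connectedin_clopen_cases[OF L, of U] pL qL by (auto simp: disjnt_iff)
qed

text \<open>The set is a countable union of affine hyperplanes.\<close>

lemma null_sets_integer_levels:
  fixes M :: "real ^ 'n::finite ^ 'm::finite"
  assumes "\<And>i. row i M \<noteq> 0"
  shows "{x. \<exists>i. (M *v x) $ i - c $ i \<in> \<int>} \<in> null_sets lborel"
proof -
  have null: "{x. row i M \<bullet> x = t} \<in> null_sets lborel" for i t
  proof -
    have "closed {x. row i M \<bullet> x = t}"
      by (rule closed_hyperplane)
    moreover have "negligible {x. row i M \<bullet> x = t}"
      using assms negligible_hyperplane by blast
    ultimately show ?thesis
      by (auto simp: negligible_iff_null_sets null_sets_def)
  qed
  have "(\<Union>i. \<Union>z::int. {x. row i M \<bullet> x = c $ i + of_int z}) \<in> null_sets lborel"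
    by (intro null_sets_UN' null) auto
  also have "(\<Union>i. \<Union>z::int. {x. row i M \<bullet> x = c $ i + of_int z}) = {x. \<exists>i. (M *v x) $ i - c $ i \<in> \<int>}"
    by (auto simp: matrix_vector_mul_component row_def Ints_def image_iff algebra_simps)
  finally show ?thesis .
qed

text \<open>The union of the other members is open as well, so a connected set that meets a member cannot
  leave it within \<open>\<Union>A\<close>.\<close>

lemma components_Union_open_connected:
  fixes A :: "'a::topological_space set set"
  assumes disj: "pairwise disjnt A"
    and A: "\<And>X. X \<in> A \<Longrightarrow> open X \<and> connected X \<and> X \<noteq> {}"
  shows "components (\<Union>A) = A"
proof -
  have eq: "C = X" if C: "C \<in> components (\<Union>A)" and X: "X \<in> A" and meet: "C \<inter> X \<noteq> {}" for C X
  proof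
    show "X \<subseteq> C"
      using components_maximal[OF C] A X meet by blast
    have "connected C" "C \<subseteq> \<Union>A"
      using C in_components_connected in_components_subset by blast+
    moreover have "X \<inter> \<Union>(A - {X}) = {}"
      using disj X by (auto simp: pairwise_def disjnt_iff)
    moreover have "open X" "open (\<Union>(A - {X}))"
      using A X by auto
    ultimately have "X \<inter> C = {} \<or> \<Union>(A - {X}) \<inter> C = {}"
      by (intro connectedD) auto
    then show "C \<subseteq> X"
      using meet \<open>C \<subseteq> \<Union>A\<close> by blast
  qed
  show ?thesis
  proof (intro equalityI subsetI)
    fix C assume C: "C \<in> components (\<Union>A)"
    then have "C \<noteq> {}" "C \<subseteq> \<Union>A"
      using in_components_nonempty in_components_subset by blast+
    then obtain X where "X \<in> A" "C \<inter> X \<noteq> {}"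
      by blast
    then show "C \<in> A"
      using eq[OF C] by blast
  next
    fix X assume X: "X \<in> A"
    then obtain x where x: "x \<in> X"
      using A by blast
    then have "connected_component_set (\<Union>A) x \<in> components (\<Union>A)" "x \<in> connected_component_set (\<Union>A) x"
      using X by (auto simp: components_def)
    then show "X \<in> components (\<Union>A)"
      using eq X x by blast
  qed
qed

theorem corollary4p4:
  fixes A :: "'n::finite torus set set"
    and H :: "'n \<Rightarrow> 'n torus set"
    and a :: "'n \<Rightarrow> int ^ 'n"
    and \<Theta> :: "int ^ 'n ^ 'n"
  assumes "toric_arrangement A"
    and "A = range H" and "inj H"
    and "\<And>i. has_normal (H i) (a i)"
    and "\<And>i. simple_normal (a i)"
    and "general_position A"
    and "spanning A"
    and "\<And>i. row i \<Theta> = a i"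
  shows "finite (regions A) \<and> int (card (regions A)) = \<bar>det \<Theta>\<bar>"
proof -
  let ?M = "real_matrix \<Theta>"
  have "\<exists>t. H i = toric_hyperplane (row i \<Theta>) (to_circle t)" for i
    using assms(4)[of i] assms(8)[of i] unfolding has_normal_def
    by (metis Quotient3_abs_rep Quotient3_circle)
  then obtain f where f: "\<And>i. H i = toric_hyperplane (row i \<Theta>) (to_circle (f i))"
    by metis
  define c where "c = (\<chi> i. f i)"
  have H: "H i = toric_hyperplane (row i \<Theta>) (to_circle (c $ i))" for i
    by (simp add: f c_def)

  \<comment> \<open>By injectivity of \<open>H\<close> there are exactly \<open>n\<close> hyperplanes, so the subset that witnesses spanning is
    all of \<open>A\<close>, and general position bounds the dimension of its intersection by \<open>n - n\<close>.\<close>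
  have cardA: "finite A" "card A = CARD('n)"
    using assms(2,3) by (auto simp: card_image)
  have "\<Inter>A \<noteq> {}"
    using assms(7) cardA card_subset_eq[of A] unfolding spanning_def by metis
  moreover have "top_of_set (\<Inter>A) dim_le 0"
  proof -
    have "A \<noteq> {}"
      using assms(2) by simp
    then show ?thesis
      using assms(6) cardA unfolding general_position_def by force
  qed
  moreover have "\<Inter>A = (\<Inter>i. toric_hyperplane (row i \<Theta>) (to_circle (c $ i)))"
    by (simp add: assms(2) H)
  ultimately have det: "det \<Theta> \<noteq> 0"
    using det_nonzero_if_intersection_dim_le_0[of _ \<Theta> "\<lambda>i. to_circle (c $ i)"] by auto
  then have detM: "det ?M \<noteq> 0"
    by (simp add: det_real_matrix)

  define R where "R k = to_torus ` cell ?M c k" for k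
  have vol_R: "torus_volume (R k) = ennreal (1 / \<bar>det ?M\<bar>)" for k
  proof -
    have "m = 0" if "x \<in> cell ?M c k" "x + int_vec m \<in> cell ?M c k" for x m
    proof -
      have "x + int_vec m \<in> cell ?M c (k + \<Theta> *v m)"
        using that by (simp add: cell_translate)
      then have "\<Theta> *v m = 0"
        using cell_index_unique[OF that(2)] by force
      then have "?M *v int_vec m = 0"
        by (simp add: real_matrix_mult_int_vec vec_eq_iff)
      then have "int_vec m = 0"
        using detM invertible_det_nz invertible_left_inverse matrix_left_invertible_ker by blast
      then show ?thesis
        by (simp add: vec_eq_iff)
    qed
    then have "torus_volume (R k) = emeasure lborel (cell ?M c k)"
      unfolding R_def by (intro torus_volume_image borel_open open_cell) blast
    then show ?thesis
      by (simp add: emeasure_cell[OF detM])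
  qed
  have R_open: "open (R k)" and R_connected: "connected (R k)" for k
    unfolding R_def
    by (intro open_image_to_torus open_cell connected_continuous_image continuous_on_to_torus
        convex_connected convex_cell)+
  have R_nonempty: "R k \<noteq> {}" for k
    using vol_R[of k] detM by (auto simp: torus_volume_def)
  have R_disjoint: "R k = R l" if meet: "R k \<inter> R l \<noteq> {}" for k l
  proof -
    have sub: "R k \<subseteq> R (k + \<Theta> *v m)" for k m
    proof
      fix p assume "p \<in> R k"
      then obtain x where "p = to_torus x" "x \<in> cell ?M c k"
        by (auto simp: R_def)
      then have "p = to_torus (x + int_vec m)" "x + int_vec m \<in> cell ?M c (k + \<Theta> *v m)"
        by (auto simp: cell_translate to_torus_eq_iff)
      then show "p \<in> R (k + \<Theta> *v m)"
        by (auto simp: R_def)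
    qed
    obtain p where p: "p \<in> R k" "p \<in> R l"
      using meet by blast
    obtain x where x: "x \<in> cell ?M c k" "p = to_torus x"
      using p(1) by (auto simp: R_def)
    obtain y where y: "y \<in> cell ?M c l" "p = to_torus y"
      using p(2) by (auto simp: R_def)
    obtain m where "y = x + int_vec m"
      using x(2) y(2) to_torus_eq_iff[of x y] by auto
    with x y have "x \<in> cell ?M c k" "x + int_vec m \<in> cell ?M c l"
      by simp_all
    then have l: "l = k + \<Theta> *v m"
      using cell_translate cell_index_unique by metis
    have "\<Theta> *v (- m) = - (\<Theta> *v m)"
      by (simp add: matrix_vector_mult_def vec_eq_iff sum_negf)
    then have "l + \<Theta> *v (- m) = k"
      by (simp add: l)
    then have "R l \<subseteq> R k"
      using sub[of l "- m"] by simp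
    moreover have "R k \<subseteq> R l"
      unfolding l by (rule sub)
    ultimately show ?thesis
      by (rule subset_antisym[rotated])
  qed

  have complement: "to_torus -` (- \<Union>A) = {x. \<forall>i. (?M *v x) $ i - c $ i \<notin> \<int>}"
    by (auto simp: assms(2) H to_torus_in_hyperplane_iff)
  have "\<Union>(range R) = to_torus ` (\<Union>k. cell ?M c k)"
    by (auto simp: R_def)
  also have "(\<Union>k. cell ?M c k) = to_torus -` (- \<Union>A)"
  proof (intro set_eqI iffI)
    fix x assume "x \<in> (\<Union>k. cell ?M c k)"
    then show "x \<in> to_torus -` (- \<Union>A)"
      unfolding complement using not_Ints_if_in_cell[of x ?M c] by auto
  next
    fix x assume "x \<in> to_torus -` (- \<Union>A)"
    then show "x \<in> (\<Union>k. cell ?M c k)"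
      unfolding complement using in_some_cell[of ?M x c] by auto
  qed
  finally have Union_R: "\<Union>(range R) = - \<Union>A"
    by (simp add: surj_to_torus)
  have pairwise_R: "pairwise disjnt (range R)"
    using R_disjoint by (auto simp: pairwise_def disjnt_def)
  have regions: "regions A = range R"
    unfolding regions_def Union_R[symmetric]
    using pairwise_R R_open R_connected R_nonempty
    by (intro components_Union_open_connected) auto

  have "row i ?M \<noteq> 0" for i
  proof -
    have "a i \<noteq> 0"
      using assms(4) by (simp add: has_normal_def)
    then show ?thesis
      using assms(8)[of i] by (auto simp: row_def real_matrix_def vec_eq_iff)
  qed
  then have null: "{x. \<exists>i. (?M *v x) $ i - c $ i \<in> \<int>} \<in> null_sets lborel"
    by (rule null_sets_integer_levels)
  \<comment> \<open>The total volume, computed first as that of the cube without a null set, then as the sum over the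
    regions.\<close>
  have "torus_volume (- \<Union>A) = emeasure lborel (unit_cube - {x. \<exists>i. (?M *v x) $ i - c $ i \<in> \<int>})"
    unfolding torus_volume_def complement by (rule arg_cong[of _ _ "emeasure lborel"]) auto
  also have "\<dots> = 1"
    using null by (simp add: emeasure_Diff_null_set emeasure_unit_cube)
  finally have total: "torus_volume (- \<Union>A) = 1" .

  let ?P = "\<lambda>X. unit_cube \<inter> to_torus -` X"
  have "torus_volume (- \<Union>A) = emeasure lborel (\<Union>X\<in>range R. ?P X)"
    unfolding torus_volume_def Union_R[symmetric] by (rule arg_cong[of _ _ "emeasure lborel"]) auto
  also have "\<dots> = (\<integral>\<^sup>+X. emeasure lborel (?P X) \<partial>count_space (range R))"
  proof (rule emeasure_UN_countable)
    show "?P X \<in> sets lborel" if "X \<in> range R" for X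
    proof -
      have "open (to_torus -` X)"
        using that R_open by (auto simp: open_torus_def)
      then show ?thesis
        using unit_cube_sets by (simp add: sets.Int)
    qed
    show "disjoint_family_on ?P (range R)"
      using pairwise_R by (force simp: disjoint_family_on_def pairwise_def disjnt_iff)
  qed simp
  also have "\<dots> = (\<integral>\<^sup>+X. ennreal (1 / \<bar>det ?M\<bar>) \<partial>count_space (range R))"
    by (rule nn_integral_cong) (use vol_R in \<open>auto simp: torus_volume_def\<close>)
  also have "\<dots> = ennreal (1 / \<bar>det ?M\<bar>) * emeasure (count_space (range R)) (range R)"
    by simp
  finally have count: "ennreal (1 / \<bar>det ?M\<bar>) * emeasure (count_space (range R)) (range R) = 1"
    using total by simp
  \<comment> \<open>Infinitely many regions of equal positive volume would have infinite total volume.\<close>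
  have fin: "finite (range R)"
  proof (rule ccontr)
    assume "infinite (range R)"
    then show False
      using count detM by (simp add: ennreal_mult_top)
  qed
  then have "ennreal (1 / \<bar>det ?M\<bar> * real (card (range R))) = 1"
    using count by (subst ennreal_mult) (simp_all add: ennreal_of_nat_eq_real_of_nat)
  then have "real (card (range R)) = \<bar>det ?M\<bar>"
    using detM by simp
  then have "of_int (int (card (range R))) = (of_int \<bar>det \<Theta>\<bar> :: real)"
    by (simp add: det_real_matrix)
  then have "int (card (range R)) = \<bar>det \<Theta>\<bar>"
    by (simp only: of_int_eq_iff)
  then show ?thesis
    using fin by (simp add: regions)
qed

end
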